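(* Let $\mathcal H,\mathcal K$ be separable complex Hilbert spaces. Let $H_0$ be a closed operator in $\mathcal H$ with $\rho(H_0)\neq\emptyset$, and let $V_1,V_2$ be (possibly unbounded) linear operators from $\mathcal H$ to $\mathcal K$ such that $V_1$ is closed, $\overline{\operatorname{dom}(V_2)}=\mathcal H$, and $\operatorname{dom}(H_0)\subseteq\operatorname{dom}(V_2^*V_1)$. Define $H=H_0+V_2^*V_1$ with $\operatorname{dom}(H)=\operatorname{dom}(H_0)$. Let $z_0\in\rho(H_0)$ and consider the operator-valued function $$\rho(H_0)\ni z\mapsto I_{\mathcal K}+V_1(H_0-zI_{\mathcal H})^{-1}V_2^*,\qquad (\ast)$$ whose values are operators in $\mathcal K$ with domain $\operatorname{dom}(V_2^* )$. Then the following hold. (i) Let $\{f_0,\dots,f_{k-1}\}\subset\operatorname{dom}(H)$, $k\in\mathbb N$, be a Jordan chain of length $k$ for $H$ at $z_0$. Define $\varphi_j=V_1f_j$ for all $j\in\{0,\dots,k-1\}$. Then $\{\varphi_0,\dots,\varphi_{k-1}\}\subset\operatorname{dom}(V_2^* )$ is a Jordan chain of length $k$ for the function $(\ast)$ at $z_0$. (ii) Let $\{\varphi_0,\dots,\varphi_{k-1}\}\subset\operatorname{dom}(V_2^* )$, $k\in\mathbb N$, be a Jordan chain of length $k$ for the function $(\ast)$ at $z_0$. Define $f_0=-(H_0-z_0I_{\mathcal H})^{-1}V_2^*\varphi_0$ and, inductively, $$f_j=(H_0-z_0I_{\mathcal H})^{-1}\Big(f_{j-1}+V_2^*\sum_{\ell=0}^{j}V_1(H_0-z_0I_{\mathcal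 H})^{-(\ell+1)}V_2^*\varphi_{j-\ell}\Big),\quad j\in\{1,\dots,k-1\}.$$ Then $\{f_0,\dots,f_{k-1}\}\subset\operatorname{dom}(H)$ is a Jordan chain of length $k$ for $H$ at $z_0$, with $V_1f_j=\varphi_j$ for all $j\in\{0,\dots,k-1\}$.
   Context: $\rho(T)$ denotes the resolvent set of a closed operator $T$. $H$ is not assumed to be closed, and $\rho(H)=\emptyset$ is allowed. Jordan chain of an operator: vectors $\{f_0,\dots,f_{k-1}\}\subset\operatorname{dom}(A)$ form a Jordan chain of length $k$ for a linear operator $A$ at $\lambda_0\in\mathbb C$ if $f_0\neq0$, $(A-\lambda_0 I)f_0=0$, and $(A-\lambda_0 I)f_j=f_{j-1}$ for $j\in\{1,\dots,k-1\}$. Jordan chain of an operator-valued function: let $A(z)$, $z\in\Omega$ ($\Omega\subset\mathbb C$ open), be linear operators in $\mathcal K$ with common domain $\mathcal D$, such that $z\mapsto A(z)\varphi$ is analytic on $\Omega$ for every $\varphi\in\mathcal D$; $A^{(\ell)}(z)\varphi$ denotes the $\ell$-th derivative of $A(\cdot)\varphi$ at $z$. Vectors $\{\varphi_0,\dots,\varphi_{k-1}\}\subset\mathcal D$ form a Jordan chain of length $k$ for $A(\cdot)$ at $\lambda_0\in\Omega$ if $\varphi_0\neq0$ and $\sum_{\ell=0}^{j}\frac1{\ell!}A^{(\ell)}(\lambda_0)\varphi_{j-\ell}=0$ for $j=0,\dots,k-1$. For the function $(\ast)$, one takes $\Omega=\rho(H_0)$ and $\mathcal D=\operatorname{dom}(V_2^*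 )$; this function is strongly analytic in this sense. *)

theory Defs
  imports "HOL-Analysis.Analysis"
begin

section \<open>Complex Hilbert spaces\<close>

text \<open>The complex structure is put on top of the real one, so that norm, topology and
  completeness are those of the library. The inner product is linear in the first argument;
  the notions below do not depend on this convention.\<close>

class complex_hilbert = real_inner + banach +
  fixes scaleC :: "complex \<Rightarrow> 'a \<Rightarrow> 'a" (infixr "*\<^sub>C" 75)
    and cinner :: "'a \<Rightarrow> 'a \<Rightarrow> complex"
  assumes scaleC_add_right: "a *\<^sub>C (x + y) = a *\<^sub>C x + a *\<^sub>C y"
    and scaleC_add_left: "(a + b) *\<^sub>C x = a *\<^sub>C x + b *\<^sub>C x"
    and scaleC_scaleC: "a *\<^sub>C (b *\<^sub>C x) = (a * b) *\<^sub>C x"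
    and scaleC_of_real: "complex_of_real r *\<^sub>C x = r *\<^sub>R x"
    and cinner_commute: "cinner x y = cnj (cinner y x)"
    and cinner_add_left: "cinner (x + y) z = cinner x z + cinner y z"
    and cinner_scaleC_left: "cinner (a *\<^sub>C x) y = a * cinner x y"
    and inner_eq_Re_cinner: "x \<bullet> y = Re (cinner x y)"

instantiation complex :: complex_hilbert
begin

definition scaleC_complex :: "complex \<Rightarrow> complex \<Rightarrow> complex"
  where "scaleC_complex a x = a * x"

definition cinner_complex :: "complex \<Rightarrow> complex \<Rightarrow> complex"
  where "cinner_complex x y = x * cnj y"

instance
  by standard
    (auto simp: scaleC_complex_def cinner_complex_def inner_complex_def algebra_simps
      scaleR_conv_of_real)

end


section \<open>Unbounded operators\<close>

text \<open>An operator is a domain together with a rule; the values of \<open>ap T\<close> outside \<open>opdom T\<close> carry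
  no meaning. Sums and products have their natural (maximal) domains.\<close>

datatype ('a, 'b) operator = Operator (opdom: "'a set") (ap: "'a \<Rightarrow> 'b")

definition linear_operator :: "('a::complex_hilbert, 'b::complex_hilbert) operator \<Rightarrow> bool" where
  "linear_operator T \<longleftrightarrow>
     0 \<in> opdom T \<and>
     (\<forall>x\<in>opdom T. \<forall>y\<in>opdom T. x + y \<in> opdom T \<and> ap T (x + y) = ap T x + ap T y) \<and>
     (\<forall>c. \<forall>x\<in>opdom T. c *\<^sub>C x \<in> opdom T \<and> ap T (c *\<^sub>C x) = c *\<^sub>C ap T x)"

definition closed_operator :: "('a::complex_hilbert, 'b::complex_hilbert) operator \<Rightarrow> bool" where
  "closed_operator T \<longleftrightarrow> linear_operator T \<and> closed ((\<lambda>x. (x, ap T x)) ` opdom T)"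

definition op_id :: "('a, 'a) operator" where
  "op_id = Operator UNIV (\<lambda>x. x)"

definition op_add :: "('a, 'b::complex_hilbert) operator \<Rightarrow> ('a, 'b) operator \<Rightarrow> ('a, 'b) operator"
  where "op_add S T = Operator (opdom S \<inter> opdom T) (\<lambda>x. ap S x + ap T x)"

definition op_comp :: "('b, 'c) operator \<Rightarrow> ('a, 'b) operator \<Rightarrow> ('a, 'c) operator" where
  "op_comp S T = Operator {x \<in> opdom T. ap T x \<in> opdom S} (\<lambda>x. ap S (ap T x))"

definition op_shift :: "('a::complex_hilbert, 'a) operator \<Rightarrow> complex \<Rightarrow> ('a, 'a) operator" where
  "op_shift T z = Operator (opdom T) (\<lambda>x. ap T x - z *\<^sub>C x)"

text \<open>Meaningful for injective \<open>T\<close>.\<close>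

definition op_inverse :: "('a, 'b) operator \<Rightarrow> ('b, 'a) operator" where
  "op_inverse T = Operator (ap T ` opdom T) (inv_into (opdom T) (ap T))"

text \<open>Meaningful for densely defined \<open>T\<close>, for which the vector \<open>w\<close> is unique.\<close>

definition op_adjoint :: "('a::complex_hilbert, 'b::complex_hilbert) operator \<Rightarrow> ('b, 'a) operator"
  where
  "op_adjoint T = Operator
     {y. \<exists>w. \<forall>x\<in>opdom T. cinner (ap T x) y = cinner x w}
     (\<lambda>y. THE w. \<forall>x\<in>opdom T. cinner (ap T x) y = cinner x w)"

definition resolvent :: "('a::complex_hilbert, 'a) operator \<Rightarrow> complex \<Rightarrow> ('a, 'a) operator" where
  "resolvent T z = op_inverse (op_shift T z)"

text \<open>Real boundedness suffices below: the inverse of a complex linear map is complex linear.\<close>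

definition resolvent_set :: "('a::complex_hilbert, 'a) operator \<Rightarrow> complex set" where
  "resolvent_set T =
     {z. inj_on (ap (op_shift T z)) (opdom T) \<and>
         opdom (resolvent T z) = UNIV \<and>
         bounded_linear (ap (resolvent T z))}"


section \<open>Jordan chains\<close>

definition jordan_chain ::
  "('a::complex_hilbert, 'a) operator \<Rightarrow> complex \<Rightarrow> nat \<Rightarrow> (nat \<Rightarrow> 'a) \<Rightarrow> bool" where
  "jordan_chain T z0 k f \<longleftrightarrow>
     1 \<le> k \<and> (\<forall>j<k. f j \<in> opdom T) \<and> f 0 \<noteq> 0 \<and>
     ap (op_shift T z0) (f 0) = 0 \<and>
     (\<forall>j\<in>{1..<k}. ap (op_shift T z0) (f j) = f (j - 1))"

text \<open>Complex derivatives of Hilbert space valued functions: the library's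
  \<^const>\<open>has_field_derivative\<close> only covers field-valued functions, so we use the Frechet derivative
  and require it to be complex linear.\<close>

definition has_cderiv :: "(complex \<Rightarrow> 'a::complex_hilbert) \<Rightarrow> 'a \<Rightarrow> complex \<Rightarrow> bool" where
  "has_cderiv g d z \<longleftrightarrow> (g has_derivative (\<lambda>h. h *\<^sub>C d)) (at z)"

definition cderiv :: "(complex \<Rightarrow> 'a::complex_hilbert) \<Rightarrow> complex \<Rightarrow> 'a" where
  "cderiv g z = (THE d. has_cderiv g d z)"

text \<open>Analyticity on an open set is complex differentiability at each of its points.\<close>

definition strongly_analytic_family ::
  "complex set \<Rightarrow> 'a set \<Rightarrow> (complex \<Rightarrow> ('a::complex_hilbert, 'a) operator) \<Rightarrow> bool" where
  "strongly_analytic_family \<Omega> D A \<longleftrightarrow>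
     open \<Omega> \<and>
     (\<forall>z\<in>\<Omega>. linear_operator (A z) \<and> opdom (A z) = D) \<and>
     (\<forall>\<phi>\<in>D. \<forall>z\<in>\<Omega>. \<exists>d. has_cderiv (\<lambda>\<zeta>. ap (A \<zeta>) \<phi>) d z)"

definition jordan_chain_family ::
  "complex set \<Rightarrow> 'a set \<Rightarrow> (complex \<Rightarrow> ('a::complex_hilbert, 'a) operator) \<Rightarrow>
   complex \<Rightarrow> nat \<Rightarrow> (nat \<Rightarrow> 'a) \<Rightarrow> bool" where
  "jordan_chain_family \<Omega> D A z0 k \<phi> \<longleftrightarrow>
     strongly_analytic_family \<Omega> D A \<and> z0 \<in> \<Omega> \<and>
     1 \<le> k \<and> (\<forall>j<k. \<phi> j \<in> D) \<and> \<phi> 0 \<noteq> 0 \<and>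
     (\<forall>j<k. (\<Sum>l\<le>j. (1 / fact l) *\<^sub>C (cderiv ^^ l) (\<lambda>z. ap (A z) (\<phi> (j - l))) z0) = 0)"

end

theory Submission
  imports Defs
begin

text \<open>
  Write \<open>R(z) = (H\<^sub>0 - z)\<^sup>-\<^sup>1\<close>, \<open>R = R(z\<^sub>0)\<close> and \<open>u\<^sub>j = V\<^sub>2\<^sup>* \<phi>\<^sub>j\<close>.

  Both notions of Jordan chain are the same recursion in disguise. On the one side, with
  \<open>\<phi>\<^sub>j = V\<^sub>1 f\<^sub>j\<close> the equations \<open>(H - z\<^sub>0) f\<^sub>j = f\<^sub>j\<^sub>-\<^sub>1\<close> say exactly that
  \<open>f\<^sub>j = R (f\<^sub>j\<^sub>-\<^sub>1 - u\<^sub>j)\<close>, where \<open>f\<^sub>-\<^sub>1 = 0\<close>; unrolled, this is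
  \<open>f\<^sub>j = - (R u\<^sub>j + R\<^sup>2 u\<^sub>j\<^sub>-\<^sub>1 + \<dots> + R\<^sup>j\<^sup>+\<^sup>1 u\<^sub>0)\<close> (lemma \<open>resolvent_recursion_solution\<close>). On the other
  side, the \<open>l\<close>-th Taylor coefficient of \<open>z \<mapsto> \<phi> + V\<^sub>1 R(z) V\<^sub>2\<^sup>* \<phi>\<close> at \<open>z\<^sub>0\<close> is
  \<open>V\<^sub>1 R\<^sup>l\<^sup>+\<^sup>1 V\<^sub>2\<^sup>* \<phi>\<close>, plus \<open>\<phi>\<close> when \<open>l = 0\<close> (lemma \<open>cderiv_pow_closed_resolvent\<close>), so the chain
  equations of the function read \<open>\<phi>\<^sub>j = - (V\<^sub>1 R u\<^sub>j + \<dots> + V\<^sub>1 R\<^sup>j\<^sup>+\<^sup>1 u\<^sub>0)\<close>. Applying \<open>V\<^sub>1\<close> to the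
  unrolled recursion turns one into the other. The formula for \<open>f\<^sub>j\<close> in the second part is the
  recursion again, since the sum in it equals \<open>- \<phi>\<^sub>j\<close>. The leading vectors vanish together because
  \<open>f\<^sub>0 = - R V\<^sub>2\<^sup>* \<phi>\<^sub>0\<close> and \<open>\<phi>\<^sub>0 = V\<^sub>1 f\<^sub>0\<close>.

  The analytic content is the Taylor expansion. It rests on the boundedness of \<open>V\<^sub>1 R(z)\<close>, which is
  closed and everywhere defined, hence bounded by the closed graph theorem, and on the resolvent
  identity in the form \<open>R(\<zeta>) = R(z) (1 + (\<zeta> - z) R(\<zeta>))\<close>: it moves the possibly unbounded \<open>V\<^sub>1\<close> in
  front of an operator that is independent of \<open>\<zeta>\<close>, so that only vectors have to be differentiated.
\<close>


section \<open>Complex scalars and complex derivatives\<close>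


lemma norm_scaleC: "norm (c *\<^sub>C x) = cmod c * norm x"
proof (rule power2_eq_imp_eq)
  have "(norm (c *\<^sub>C x))\<^sup>2 = Re (cinner (c *\<^sub>C x) (c *\<^sub>C x))"
    by (simp add: power2_norm_eq_inner inner_eq_Re_cinner)
  also have "cinner (c *\<^sub>C x) (c *\<^sub>C x) = (c * cnj c) * cnj (cinner x x)"
    by (metis cinner_commute cinner_scaleC_left complex_cnj_mult mult.assoc)
  also have "\<dots> = complex_of_real ((cmod c)\<^sup>2) * cnj (cinner x x)"
    by (simp only: complex_norm_square)
  finally show "(norm (c *\<^sub>C x))\<^sup>2 = (cmod c * norm x)\<^sup>2"
    by (simp add: power_mult_distrib power2_norm_eq_inner inner_eq_Re_cinner
        flip: of_real_power)
qed auto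

text \<open>This gives access to the library's rules for limits, derivatives and sums of products.\<close>

interpretation scaleC: bounded_bilinear "scaleC :: complex \<Rightarrow> 'a::complex_hilbert \<Rightarrow> 'a"
proof
  show "(r *\<^sub>R c) *\<^sub>C x = r *\<^sub>R (c *\<^sub>C x)" "c *\<^sub>C (r *\<^sub>R x) = r *\<^sub>R (c *\<^sub>C x)" for r c and x :: 'a
    by (simp_all add: scaleR_conv_of_real scaleC_scaleC mult.commute
        flip: scaleC_of_real[where ?'a = 'a])
  show "\<exists>K. \<forall>c (x :: 'a). norm (c *\<^sub>C x) \<le> norm c * norm x * K"
    by (intro exI[of _ 1]) (simp add: norm_scaleC)
qed (simp_all add: scaleC_add_left scaleC_add_right)

lemma scaleC_one [simp]: "1 *\<^sub>C x = x"
  using scaleC_of_real[of 1 x] by simp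

lemma has_cderiv_unique: "has_cderiv g d z \<Longrightarrow> has_cderiv g d' z \<Longrightarrow> d = d'"
  unfolding has_cderiv_def by (metis has_derivative_unique scaleC_one)

lemma cderiv_eqI: "has_cderiv g d z \<Longrightarrow> cderiv g z = d"
  unfolding cderiv_def by (blast intro: the_equality has_cderiv_unique)

lemma has_cderiv_cong_open:
  assumes "has_cderiv g d z" "open S" "z \<in> S" "\<And>\<zeta>. \<zeta> \<in> S \<Longrightarrow> g \<zeta> = h \<zeta>"
  shows "has_cderiv h d z"
  using assms unfolding has_cderiv_def by (rule has_derivative_transform_within_open)

lemma has_cderiv_const: "has_cderiv (\<lambda>_. x) 0 z"
  unfolding has_cderiv_def by (simp add: scaleC.zero_right)

lemma has_cderiv_add:
  "has_cderiv g d z \<Longrightarrow> has_cderiv h e z \<Longrightarrow> has_cderiv (\<lambda>\<zeta>. g \<zeta> + h \<zeta>) (d + e) z"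
  unfolding has_cderiv_def scaleC_add_right by (rule has_derivative_add)

definition bounded_clinear :: "('a::complex_hilbert \<Rightarrow> 'b::complex_hilbert) \<Rightarrow> bool" where
  "bounded_clinear B \<longleftrightarrow> bounded_linear B \<and> (\<forall>c x. B (c *\<^sub>C x) = c *\<^sub>C B x)"

lemma has_cderiv_bounded_clinear:
  assumes "has_cderiv g d z" "bounded_clinear B"
  shows "has_cderiv (\<lambda>\<zeta>. B (g \<zeta>)) (B d) z"
  using bounded_linear.has_derivative[of B g "\<lambda>h. h *\<^sub>C d" "at z"] assms
  unfolding has_cderiv_def bounded_clinear_def by simp

text \<open>The product rule at a zero of the scalar factor: there the other factor only has to be
  continuous. This is what makes the resolvent differentiable as soon as it is continuous.\<close>

lemma has_cderiv_linear_factor: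
  assumes "(k \<longlongrightarrow> k z) (at z)"
  shows "has_cderiv (\<lambda>\<zeta>. (\<zeta> - z) *\<^sub>C k \<zeta>) (k z) z"
proof -
  have "((\<lambda>\<zeta>. (\<zeta> - z) *\<^sub>C (k \<zeta> - k z) /\<^sub>R norm (\<zeta> - z)) \<longlongrightarrow> 0) (at z)"
  proof (rule Lim_null_comparison)
    show "\<forall>\<^sub>F \<zeta> in at z. norm ((\<zeta> - z) *\<^sub>C (k \<zeta> - k z) /\<^sub>R norm (\<zeta> - z)) \<le> norm (k \<zeta> - k z)"
    proof (intro always_eventually allI)
      show "norm ((\<zeta> - z) *\<^sub>C (k \<zeta> - k z) /\<^sub>R norm (\<zeta> - z)) \<le> norm (k \<zeta> - k z)" for \<zeta>
        by (cases "\<zeta> = z") (simp_all add: norm_scaleC flip: mult.assoc)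
    qed
    show "((\<lambda>\<zeta>. norm (k \<zeta> - k z)) \<longlongrightarrow> 0) (at z)"
      using assms by (simp add: LIM_zero_iff tendsto_norm_zero_iff)
  qed
  then show ?thesis
    unfolding has_cderiv_def has_derivative_at_within
    by (simp add: scaleC.bounded_linear_left scaleC.diff_right scaleC.zero_left)
qed


section \<open>The closed graph theorem\<close>

text \<open>By Baire, the closure of some sublevel set \<open>{x. norm (T x) \<le> n}\<close> contains a ball; differences
  of its points show that every \<open>x\<close> is approximated with relative error \<open>1/2\<close> by some \<open>y\<close> with
  \<open>norm (T y) \<le> K * norm x\<close>. Approximating the remainders in turn writes \<open>x\<close> as a series whose image
  under \<open>T\<close> converges absolutely, and the closed graph identifies the sum with \<open>T x\<close>.\<close>

theorem closed_graph:
  fixes T :: "'a::banach \<Rightarrow> 'b::banach"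
  assumes "linear T" and graph: "closed (range (\<lambda>x. (x, T x)))"
  shows "bounded_linear T"
proof -
  interpret T: linear T by fact
  let ?F = "\<lambda>n::nat. closure {x. norm (T x) \<le> real n}"
  obtain n where "interior (?F n) \<noteq> {}"
  proof (rule ccontr)
    assume "\<not> thesis"
    then have "interior (?F n) = {}" for n using that by blast
    then have "euclidean interior_of \<Union>(range ?F) = {}"
      by (intro Baire_category_alt) (auto simp: completely_metrizable_space_euclidean)
    moreover have "\<Union>(range ?F) = UNIV"
    proof (intro equalityI subsetI)
      fix x :: 'a
      obtain n where "norm (T x) \<le> real n" using real_arch_simple by blast
      then have "x \<in> ?F n" by (intro subsetD[OF closure_subset]) simp
      then show "x \<in> \<Union>(range ?F)" by blast
    qed simp
    ultimately show False by simp
  qed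
  then obtain a e where e: "e > 0" "ball a e \<subseteq> ?F n"
    by (metis all_not_in_conv mem_interior)
  define K where "K = 4 * real n / e"
  have approx: "\<exists>y. norm (x - y) \<le> norm x / 2 \<and> norm (T y) \<le> K * norm x" for x
  proof (cases "x = 0")
    case False
    \<comment> \<open>\<open>t\<close> shrinks \<open>x\<close> so that \<open>a + t x\<close> stays in the ball. An error of \<open>e / 8\<close> at both ends
      then becomes, after division by \<open>t\<close>, the relative error \<open>1/2\<close>.\<close>
    define t where "t = e / (2 * norm x)"
    have t: "t > 0" "norm (t *\<^sub>R x) = e / 2" using False e by (auto simp: t_def)
    have "a \<in> ?F n" "a + t *\<^sub>R x \<in> ?F n"
      using e t by (auto simp: subset_iff dist_norm)
    moreover have "e / 8 > 0" using e by simp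
    ultimately obtain u v where u: "norm (T u) \<le> n" "dist u a < e/8"
      and v: "norm (T v) \<le> n" "dist v (a + t *\<^sub>R x) < e/8"
      unfolding closure_approachable by blast
    have "norm (t *\<^sub>R x - (v - u)) < e / 4"
    proof -
      have "t *\<^sub>R x - (v - u) = (u - a) - (v - (a + t *\<^sub>R x))" by simp
      then have "norm (t *\<^sub>R x - (v - u)) \<le> dist u a + dist v (a + t *\<^sub>R x)"
        unfolding dist_norm by (metis norm_triangle_ineq4)
      then show ?thesis using u(2) v(2) by simp
    qed
    moreover have "t *\<^sub>R x - (v - u) = t *\<^sub>R (x - (1/t) *\<^sub>R (v - u))"
      using t by (simp add: scaleR_diff_right)
    ultimately have "t * norm (x - (1/t) *\<^sub>R (v - u)) < e / 4" using t by simp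
    then have 1: "norm (x - (1/t) *\<^sub>R (v - u)) \<le> norm x / 2"
      using t False e by (simp add: t_def field_simps)
    have "norm (T (v - u)) \<le> 2 * n"
      using u(1) v(1) norm_triangle_ineq4[of "T v" "T u"] by (simp add: T.diff)
    then have "norm (T ((1/t) *\<^sub>R (v - u))) \<le> (1/t) * (2 * n)"
      using t by (simp add: T.scaleR divide_right_mono)
    also have "\<dots> = K * norm x"
      using False e by (simp add: t_def K_def field_simps)
    finally show ?thesis using 1 by blast
  qed (auto intro!: exI[of _ 0] simp: T.zero)
  then obtain Y where Y: "\<And>x. norm (x - Y x) \<le> norm x / 2" "\<And>x. norm (T (Y x)) \<le> K * norm x"
    by metis
  have K: "K \<ge> 0" using e by (simp add: K_def)
  have "norm (T x) \<le> norm x * (2 * K)" for x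
  proof -
    define r where "r = (\<lambda>k. ((\<lambda>x. x - Y x) ^^ k) x)"
    have r: "r 0 = x" "r (Suc k) = r k - Y (r k)" for k by (simp_all add: r_def)
    have rk: "norm (r k) \<le> norm x * (1/2)^k" for k
    proof (induction k)
      case (Suc k)
      then show ?case using Y(1)[of "r k"] by (simp add: r)
    qed (simp add: r)
    have bound: "norm (T (Y (r k))) \<le> K * norm x * (1/2)^k" for k
      using Y(2)[of "r k"] mult_left_mono[OF rk[of k] K] by (simp add: mult.assoc)
    have g: "(\<lambda>k. K * norm x * (1/2)^k) sums (K * norm x * 2)"
      using geometric_sums[of "1/2::real"] by (intro sums_mult) simp
    have summ: "summable (\<lambda>k. T (Y (r k)))"
      using bound sums_summable[OF g] by (rule summable_comparison_test'[rotated])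
    have part: "T (x - r k) = (\<Sum>i<k. T (Y (r i)))" for k
      by (induction k) (simp_all add: r T.diff T.add T.zero algebra_simps)
    have "r \<longlonglongrightarrow> 0"
    proof (rule Lim_null_comparison)
      show "\<forall>\<^sub>F k in sequentially. norm (r k) \<le> norm x * (1/2)^k" using rk by simp
      show "(\<lambda>k. norm x * (1/2)^k) \<longlonglongrightarrow> 0"
        by (intro tendsto_mult_right_zero LIMSEQ_realpow_zero) auto
    qed
    then have "(\<lambda>k. x - r k) \<longlonglongrightarrow> x" using tendsto_diff[of "\<lambda>_. x" x] by fastforce
    moreover have "(\<lambda>k. T (x - r k)) \<longlonglongrightarrow> (\<Sum>k. T (Y (r k)))"
      unfolding part by (rule summable_LIMSEQ[OF summ])
    ultimately have "(\<lambda>k. (x - r k, T (x - r k))) \<longlonglongrightarrow> (x, \<Sum>k. T (Y (r k)))"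
      by (rule tendsto_Pair)
    then have "(x, \<Sum>k. T (Y (r k))) \<in> range (\<lambda>x. (x, T x))"
      by (rule closed_sequentially[OF graph, rotated]) auto
    then have "T x = (\<Sum>k. T (Y (r k)))" by auto
    then have "norm (T x) \<le> (\<Sum>k. K * norm x * (1/2)^k)"
      using norm_suminf_le[OF bound sums_summable[OF g]] by simp
    then show ?thesis using sums_unique[OF g] by (simp add: mult.commute mult.left_commute)
  qed
  then show ?thesis
    by (intro bounded_linear_intro[where K = "2 * K"]) (simp_all add: T.add T.scaleR)
qed


section \<open>Adjoints of densely defined operators\<close>

lemma cinner_add_right: "cinner x (y + z) = cinner x y + cinner x z"
  by (metis cinner_add_left cinner_commute complex_cnj_add)

lemma cinner_scaleC_right: "cinner x (c *\<^sub>C y) = cnj c * cinner x y"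
  by (metis cinner_commute cinner_scaleC_left complex_cnj_mult)

lemma eq_if_cinner_eq_on_dense:
  assumes "closure D = UNIV" and eq: "\<And>x. x \<in> D \<Longrightarrow> cinner x w = cinner x w'"
  shows "w = w'"
proof -
  have "x \<bullet> w = x \<bullet> w'" if "x \<in> D" for x
    using eq[OF that] by (simp add: inner_eq_Re_cinner)
  then have "D \<subseteq> {x. x \<bullet> (w - w') = 0}"
    by (auto simp: inner_diff_right)
  moreover have "closed {x. x \<bullet> (w - w') = 0}"
    by (intro closed_Collect_eq continuous_intros)
  ultimately have "closure D \<subseteq> {x. x \<bullet> (w - w') = 0}" by (rule closure_minimal)
  then have "(w - w') \<bullet> (w - w') = 0" using assms(1) by blast
  then show ?thesis by simp
qed

lemma op_adjointI:
  assumes "closure (opdom V) = UNIV"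
    and eq: "\<And>x. x \<in> opdom V \<Longrightarrow> cinner (ap V x) y = cinner x w"
  shows "y \<in> opdom (op_adjoint V)" "ap (op_adjoint V) y = w"
  using eq eq_if_cinner_eq_on_dense[OF assms(1)]
  by (auto simp: op_adjoint_def intro!: the_equality)

lemma op_adjointD:
  assumes "closure (opdom V) = UNIV" "y \<in> opdom (op_adjoint V)" "x \<in> opdom V"
  shows "cinner (ap V x) y = cinner x (ap (op_adjoint V) y)"
proof -
  obtain w where w: "\<And>x. x \<in> opdom V \<Longrightarrow> cinner (ap V x) y = cinner x w"
    using assms(2) by (auto simp: op_adjoint_def)
  then show ?thesis using op_adjointI(2)[OF assms(1) w] assms(3) by simp
qed

lemma linear_operator_adjoint:
  assumes "closure (opdom V) = UNIV"
  shows "linear_operator (op_adjoint V)"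
proof -
  note D = op_adjointD[OF assms] and I = op_adjointI[OF assms]
  have zero: "cinner x 0 = 0" for x :: "'x::complex_hilbert"
    using cinner_add_right[of x 0 0] by simp
  show ?thesis
    unfolding linear_operator_def
  proof (intro conjI ballI allI)
    show "0 \<in> opdom (op_adjoint V)" by (rule I(1)[of _ 0]) (simp add: zero)
    fix y y' c assume y: "y \<in> opdom (op_adjoint V)"
    have "cinner (ap V x) (c *\<^sub>C y) = cinner x (c *\<^sub>C ap (op_adjoint V) y)" if "x \<in> opdom V" for x
      using D[OF y that] by (simp add: cinner_scaleC_right)
    then show "c *\<^sub>C y \<in> opdom (op_adjoint V)"
      "ap (op_adjoint V) (c *\<^sub>C y) = c *\<^sub>C ap (op_adjoint V) y"
      using I by blast+
    assume y': "y' \<in> opdom (op_adjoint V)"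
    have "cinner (ap V x) (y + y') = cinner x (ap (op_adjoint V) y + ap (op_adjoint V) y')"
      if "x \<in> opdom V" for x
      using D[OF y that] D[OF y' that] by (simp add: cinner_add_right)
    then show "y + y' \<in> opdom (op_adjoint V)"
      "ap (op_adjoint V) (y + y') = ap (op_adjoint V) y + ap (op_adjoint V) y'"
      using I by blast+
  qed
qed


section \<open>Resolvents\<close>

lemma linear_operatorD:
  assumes "linear_operator T"
  shows "0 \<in> opdom T" "ap T 0 = 0"
    "x \<in> opdom T \<Longrightarrow> y \<in> opdom T \<Longrightarrow> x + y \<in> opdom T"
    "x \<in> opdom T \<Longrightarrow> y \<in> opdom T \<Longrightarrow> ap T (x + y) = ap T x + ap T y"
    "x \<in> opdom T \<Longrightarrow> c *\<^sub>C x \<in> opdom T"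
    "x \<in> opdom T \<Longrightarrow> ap T (c *\<^sub>C x) = c *\<^sub>C ap T x"
  using assms scaleC.zero_left unfolding linear_operator_def by (blast, metis, blast+)

text \<open>The algebraic part of \<open>z \<in> resolvent_set T\<close>. It is kept apart because, when openness of the
  resolvent set is proved, it is known before boundedness of the inverse, and the bound is derived
  from it.\<close>

abbreviation (input) shift_bij :: "('a::complex_hilbert, 'a) operator \<Rightarrow> complex \<Rightarrow> bool" where
  "shift_bij T z \<equiv> bij_betw (ap (op_shift T z)) (opdom T) UNIV"

lemma resolvent_set_bij: "z \<in> resolvent_set T \<Longrightarrow> shift_bij T z"
  by (simp add: resolvent_set_def resolvent_def op_inverse_def op_shift_def bij_betw_def)

lemma opdom_resolvent: "z \<in> resolvent_set T \<Longrightarrow> opdom (resolvent T z) = UNIV"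
  by (simp add: resolvent_set_def)

lemma resolvent_solves:
  assumes "shift_bij T z"
  shows "ap (resolvent T z) y \<in> opdom T"
    "ap T (ap (resolvent T z) y) - z *\<^sub>C ap (resolvent T z) y = y"
  using bij_betw_imp_surj_on[OF assms] inv_into_into[of y "ap (op_shift T z)" "opdom T"]
    f_inv_into_f[of y "ap (op_shift T z)" "opdom T"]
  by (auto simp: resolvent_def op_inverse_def op_shift_def)

lemma resolvent_eqI:
  assumes "shift_bij T z" "x \<in> opdom T" "ap T x - z *\<^sub>C x = y"
  shows "ap (resolvent T z) y = x"
  using inv_into_f_f[OF bij_betw_imp_inj_on[OF assms(1)], of x] assms(2,3)
  by (auto simp: resolvent_def op_inverse_def op_shift_def)

lemma resolvent_linear:
  assumes "linear_operator T" "shift_bij T z"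
  shows "ap (resolvent T z) (x + y) = ap (resolvent T z) x + ap (resolvent T z) y"
    and "ap (resolvent T z) (c *\<^sub>C x) = c *\<^sub>C ap (resolvent T z) x"
proof -
  note T = linear_operatorD[OF assms(1)] and R = resolvent_solves[OF assms(2)]
  show "ap (resolvent T z) (x + y) = ap (resolvent T z) x + ap (resolvent T z) y"
    using R(2)[of x] R(2)[of y]
    by (intro resolvent_eqI[OF assms(2)] T R) (simp add: T R scaleC_add_right add_diff_add)
  have "ap T (c *\<^sub>C ap (resolvent T z) x) - z *\<^sub>C c *\<^sub>C ap (resolvent T z) x
    = c *\<^sub>C (ap T (ap (resolvent T z) x) - z *\<^sub>C ap (resolvent T z) x)"
    by (simp add: T R(1) scaleC.diff_right scaleC_scaleC mult.commute)
  then show "ap (resolvent T z) (c *\<^sub>C x) = c *\<^sub>C ap (resolvent T z) x"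
    by (intro resolvent_eqI[OF assms(2)] T R) (simp add: R)
qed

lemma bounded_clinear_resolvent:
  assumes "linear_operator T" "z \<in> resolvent_set T"
  shows "bounded_clinear (ap (resolvent T z))"
  using assms resolvent_linear(2)[OF assms(1) resolvent_set_bij[OF assms(2)]]
  by (auto simp: bounded_clinear_def resolvent_set_def)

lemma mem_resolvent_setI:
  assumes "linear_operator T" "shift_bij T z"
    and "\<And>y. norm (ap (resolvent T z) y) \<le> norm y * K"
  shows "z \<in> resolvent_set T"
proof -
  have "bounded_linear (ap (resolvent T z))"
  proof (rule bounded_linear_intro[OF _ _ assms(3)])
    show "ap (resolvent T z) (r *\<^sub>R x) = r *\<^sub>R ap (resolvent T z) x" for r x
      using resolvent_linear(2)[OF assms(1,2), of "of_real r"] by (simp add: scaleC_of_real)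
  qed (rule resolvent_linear(1)[OF assms(1,2)])
  then show ?thesis
    using assms(2)
    by (simp add: resolvent_set_def resolvent_def op_inverse_def op_shift_def bij_betw_def)
qed

text \<open>Solving \<open>(T - w) x = y\<close> with the inverse of \<open>T - z\<close> at hand: rewrite it as
  \<open>(T - z) x = y + (w - z) x\<close>. For \<open>w\<close> near \<open>z\<close> the resulting fixed point equation is that of a
  contraction; for \<open>w\<close> in the resolvent set the equivalence gives the resolvent identity.\<close>

lemma shift_eq_iff_fixpoint:
  assumes "shift_bij T z"
  shows "x \<in> opdom T \<and> ap T x - w *\<^sub>C x = y \<longleftrightarrow> ap (resolvent T z) (y + (w - z) *\<^sub>C x) = x"
proof
  assume "x \<in> opdom T \<and> ap T x - w *\<^sub>C x = y"
  then show "ap (resolvent T z) (y + (w - z) *\<^sub>C x) = x"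
    by (intro resolvent_eqI[OF assms]) (auto simp: scaleC.diff_left)
next
  assume x: "ap (resolvent T z) (y + (w - z) *\<^sub>C x) = x"
  then have "ap T x - z *\<^sub>C x = y + (w - z) *\<^sub>C x" "x \<in> opdom T"
    using resolvent_solves[OF assms, of "y + (w - z) *\<^sub>C x"] by simp_all
  then show "x \<in> opdom T \<and> ap T x - w *\<^sub>C x = y"
    by (simp add: scaleC.diff_left algebra_simps)
qed

lemma resolvent_identity:
  assumes "z \<in> resolvent_set T" "w \<in> resolvent_set T"
  shows "ap (resolvent T w) y
    = ap (resolvent T z) (y + (w - z) *\<^sub>C ap (resolvent T w) y)"
  using shift_eq_iff_fixpoint[OF resolvent_set_bij[OF assms(1)]]
    resolvent_solves[OF resolvent_set_bij[OF assms(2)], of y] by metis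

text \<open>Banach's fixed point theorem solves \<open>(T - w) x = y\<close> uniquely for \<open>w\<close> near \<open>z\<close>, and the fixed
  point equation bounds the solution uniformly in \<open>w\<close>.\<close>

lemma resolvent_perturbation:
  assumes "linear_operator T" "z \<in> resolvent_set T"
  obtains d K where "d > 0" "ball z d \<subseteq> resolvent_set T"
    "\<And>w y. w \<in> ball z d \<Longrightarrow> norm (ap (resolvent T w) y) \<le> norm y * K"
proof -
  note bij = resolvent_set_bij[OF assms(2)]
  interpret R: bounded_linear "ap (resolvent T z)"
    using assms(2) by (simp add: resolvent_set_def)
  obtain K where K: "K > 0" "\<And>x. norm (ap (resolvent T z) x) \<le> norm x * K"
    using R.pos_bounded by blast
  \<comment> \<open>this radius makes the contraction constant \<open>1/2\<close>\<close>
  define d where "d = 1 / (2 * K)"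
  have small: "norm (ap (resolvent T z) ((w - z) *\<^sub>C x)) \<le> norm x / 2" if "w \<in> ball z d" for w x
  proof -
    have "cmod (w - z) * K \<le> 1 / 2"
      using that K(1) by (simp add: d_def dist_norm norm_minus_commute field_simps)
    then have "(cmod (w - z) * K) * norm x \<le> 1 / 2 * norm x" by (rule mult_right_mono) simp
    then show ?thesis using K(2)[of "(w - z) *\<^sub>C x"] by (simp add: norm_scaleC mult_ac)
  qed
  have unique: "\<exists>!x. x \<in> opdom T \<and> ap T x - w *\<^sub>C x = y" if w: "w \<in> ball z d" for w y
    unfolding shift_eq_iff_fixpoint[OF bij]
  proof (rule banach_fix_type[of "1/2"])
    show "\<forall>x x'. dist (ap (resolvent T z) (y + (w - z) *\<^sub>C x))
        (ap (resolvent T z) (y + (w - z) *\<^sub>C x')) \<le> 1/2 * dist x x'"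
    proof (intro allI)
      fix x x'
      have "ap (resolvent T z) (y + (w - z) *\<^sub>C x) - ap (resolvent T z) (y + (w - z) *\<^sub>C x')
        = ap (resolvent T z) ((w - z) *\<^sub>C (x - x'))"
        by (simp add: scaleC.diff_right flip: R.diff)
      then show "dist (ap (resolvent T z) (y + (w - z) *\<^sub>C x))
        (ap (resolvent T z) (y + (w - z) *\<^sub>C x')) \<le> 1/2 * dist x x'"
        using small[OF w, of "x - x'"] by (simp add: dist_norm)
    qed
  qed auto
  have bij_w: "shift_bij T w" if "w \<in> ball z d" for w
  proof (rule bij_betwI')
    show "ap (op_shift T w) x = ap (op_shift T w) x' \<longleftrightarrow> x = x'"
      if "x \<in> opdom T" "x' \<in> opdom T" for x x'
      using that unique[OF \<open>w \<in> ball z d\<close>, of "ap T x - w *\<^sub>C x"]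
      unfolding op_shift_def operator.sel by metis
    show "\<exists>x\<in>opdom T. y = ap (op_shift T w) x" for y
      using unique[OF \<open>w \<in> ball z d\<close>, of y] unfolding op_shift_def operator.sel by metis
  qed simp
  have bound: "norm (ap (resolvent T w) y) \<le> norm y * (2 * K)" if w: "w \<in> ball z d" for w y
  proof -
    let ?x = "ap (resolvent T w) y"
    have "?x = ap (resolvent T z) (y + (w - z) *\<^sub>C ?x)"
      using shift_eq_iff_fixpoint[OF bij] resolvent_solves[OF bij_w[OF w], of y] by metis
    then have "norm ?x \<le> norm (ap (resolvent T z) y) + norm (ap (resolvent T z) ((w - z) *\<^sub>C ?x))"
      by (metis R.add norm_triangle_ineq)
    then show ?thesis using small[OF w, of ?x] K(2)[of y] by simp
  qed
  show thesis
  proof (rule that)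
    show "d > 0" using K by (simp add: d_def)
    show "ball z d \<subseteq> resolvent_set T"
      using mem_resolvent_setI[OF assms(1) bij_w bound] by blast
  qed (rule bound)
qed

lemma open_resolvent_set: "linear_operator T \<Longrightarrow> open (resolvent_set T)"
  unfolding open_contains_ball by (metis resolvent_perturbation)


section \<open>Derivatives of resolvents\<close>

text \<open>With \<open>R(\<zeta>) = (T - \<zeta>)\<^sup>-\<^sup>1\<close>, the function differentiated here is \<open>(T - z) R(\<zeta>) g(\<zeta>)\<close>.
  In this form the resolvent occurs only with the factor \<open>\<zeta> - z\<close>, so continuity of \<open>\<zeta> \<mapsto> R(\<zeta>) g(\<zeta>)\<close> at \<open>z\<close> suffices, and that follows
  from the local bound and the resolvent identity.\<close>

lemma has_cderiv_shift_resolvent: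
  assumes T: "linear_operator T" and z: "z \<in> resolvent_set T" and g: "has_cderiv g d z"
  shows "has_cderiv (\<lambda>\<zeta>. g \<zeta> + (\<zeta> - z) *\<^sub>C ap (resolvent T \<zeta>) (g \<zeta>))
    (d + ap (resolvent T z) (g z)) z"
proof -
  let ?R = "\<lambda>\<zeta>. ap (resolvent T \<zeta>)"
  obtain r K where r: "r > 0" "ball z r \<subseteq> resolvent_set T"
    "\<And>w y. w \<in> ball z r \<Longrightarrow> norm (?R w y) \<le> norm y * K"
    using resolvent_perturbation[OF T z] by blast
  have near: "\<forall>\<^sub>F \<zeta> in at z. \<zeta> \<in> ball z r"
    using r(1) by (intro eventually_at_in_open') auto
  have g_lim: "(g \<longlongrightarrow> g z) (at z)"
    using has_derivative_continuous[OF g[unfolded has_cderiv_def]] by (simp add: isCont_def)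
  have "((\<lambda>\<zeta>. (\<zeta> - z) *\<^sub>C ?R \<zeta> (g \<zeta>)) \<longlongrightarrow> 0) (at z)"
  proof (rule Lim_null_comparison)
    show "\<forall>\<^sub>F \<zeta> in at z. norm ((\<zeta> - z) *\<^sub>C ?R \<zeta> (g \<zeta>)) \<le> cmod (\<zeta> - z) * (norm (g \<zeta>) * K)"
      using near by eventually_elim (simp add: norm_scaleC mult_left_mono r(3))
    have "((\<lambda>\<zeta>. cmod (\<zeta> - z) * (norm (g \<zeta>) * K)) \<longlongrightarrow> cmod (z - z) * (norm (g z) * K)) (at z)"
      by (intro tendsto_intros g_lim)
    then show "((\<lambda>\<zeta>. cmod (\<zeta> - z) * (norm (g \<zeta>) * K)) \<longlongrightarrow> 0) (at z)" by simp
  qed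
  from tendsto_add[OF g_lim this]
  have "((\<lambda>\<zeta>. g \<zeta> + (\<zeta> - z) *\<^sub>C ?R \<zeta> (g \<zeta>)) \<longlongrightarrow> g z) (at z)" by simp
  from bounded_linear.tendsto[OF _ this, of "?R z"]
  have "((\<lambda>\<zeta>. ?R z (g \<zeta> + (\<zeta> - z) *\<^sub>C ?R \<zeta> (g \<zeta>))) \<longlongrightarrow> ?R z (g z)) (at z)"
    using z by (simp add: resolvent_set_def)
  then have "((\<lambda>\<zeta>. ?R \<zeta> (g \<zeta>)) \<longlongrightarrow> ?R z (g z)) (at z)"
  proof (rule Lim_transform_eventually)
    show "\<forall>\<^sub>F \<zeta> in at z. ?R z (g \<zeta> + (\<zeta> - z) *\<^sub>C ?R \<zeta> (g \<zeta>)) = ?R \<zeta> (g \<zeta>)"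
      using near
    proof eventually_elim
      case (elim \<zeta>)
      then have "\<zeta> \<in> resolvent_set T" using r(2) by blast
      then show ?case by (rule resolvent_identity[OF z, symmetric])
    qed
  qed
  then show ?thesis by (intro has_cderiv_add g has_cderiv_linear_factor)
qed

text \<open>\<open>V\<close> itself may be unbounded, but \<open>V R(z)\<close> is defined everywhere and inherits a closed graph
  from \<open>V\<close> because \<open>R(z)\<close> is continuous.\<close>

lemma bounded_clinear_closed_resolvent:
  assumes V: "closed_operator V" and T: "linear_operator T" "z \<in> resolvent_set T"
    and sub: "opdom T \<subseteq> opdom V"
  shows "bounded_clinear (\<lambda>y. ap V (ap (resolvent T z) y))"
proof -
  have lin: "linear_operator V" using V by (simp add: closed_operator_def)
  note V' = linear_operatorD[OF lin]
  have R: "bounded_clinear (ap (resolvent T z))" by (rule bounded_clinear_resolvent[OF T])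
  then interpret R: bounded_linear "ap (resolvent T z)" by (simp add: bounded_clinear_def)
  have mem: "ap (resolvent T z) y \<in> opdom V" for y
    using sub resolvent_solves(1)[OF resolvent_set_bij[OF T(2)]] by blast
  have hom: "ap V (ap (resolvent T z) (c *\<^sub>C y)) = c *\<^sub>C ap V (ap (resolvent T z) y)" for c y
    using R by (simp add: bounded_clinear_def V' mem)
  have "bounded_linear (\<lambda>y. ap V (ap (resolvent T z) y))"
  proof (rule closed_graph)
    show "linear (\<lambda>y. ap V (ap (resolvent T z) y))"
    proof (rule linearI)
      show "ap V (ap (resolvent T z) (r *\<^sub>R y)) = r *\<^sub>R ap V (ap (resolvent T z) y)" for r y
        using hom[of "of_real r"] by (simp add: scaleC_of_real)
    qed (simp add: R.add V' mem)
    have "range (\<lambda>y. (y, ap V (ap (resolvent T z) y)))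
      = (\<lambda>(y, v). (ap (resolvent T z) y, v)) -` ((\<lambda>x. (x, ap V x)) ` opdom V)"
      using mem by (auto simp: image_iff)
    also have "closed \<dots>"
    proof (rule continuous_closed_vimage)
      show "closed ((\<lambda>x. (x, ap V x)) ` opdom V)" using V by (simp add: closed_operator_def)
      show "isCont (\<lambda>(y, v). (ap (resolvent T z) y, v :: 'b)) p" for p
        unfolding case_prod_unfold by (intro continuous_intros R.isCont)
    qed
    finally show "closed (range (\<lambda>y. (y, ap V (ap (resolvent T z) y))))" .
  qed
  then show ?thesis using hom by (simp add: bounded_clinear_def)
qed

text \<open>On the resolvent set the function is the fixed bounded operator \<open>V R(z)\<close> applied to
  \<open>g(\<zeta>) + (\<zeta> - z) R(\<zeta>) g(\<zeta>)\<close>.\<close>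

lemma has_cderiv_closed_resolvent:
  assumes V: "closed_operator V" and T: "linear_operator T" "z \<in> resolvent_set T"
    and sub: "opdom T \<subseteq> opdom V" and g: "has_cderiv g d z"
  shows "has_cderiv (\<lambda>\<zeta>. ap V (ap (resolvent T \<zeta>) (g \<zeta>)))
    (ap V (ap (resolvent T z) (d + ap (resolvent T z) (g z)))) z"
proof (rule has_cderiv_cong_open[OF _ open_resolvent_set[OF T(1)] T(2)])
  show "has_cderiv (\<lambda>\<zeta>. ap V (ap (resolvent T z) (g \<zeta> + (\<zeta> - z) *\<^sub>C ap (resolvent T \<zeta>) (g \<zeta>))))
    (ap V (ap (resolvent T z) (d + ap (resolvent T z) (g z)))) z"
    by (rule has_cderiv_bounded_clinear[OF has_cderiv_shift_resolvent[OF T g]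
        bounded_clinear_closed_resolvent[OF V T sub]])
  show "ap V (ap (resolvent T z) (g \<zeta> + (\<zeta> - z) *\<^sub>C ap (resolvent T \<zeta>) (g \<zeta>)))
    = ap V (ap (resolvent T \<zeta>) (g \<zeta>))" if "\<zeta> \<in> resolvent_set T" for \<zeta>
    by (rule arg_cong[OF resolvent_identity[OF T(2) that, symmetric]])
qed

text \<open>With \<open>V\<close> the identity, the preceding lemma differentiates powers of the resolvent.\<close>

lemma closed_operator_id: "closed_operator (op_id :: ('a::complex_hilbert, 'a) operator)"
proof -
  have "closed (range (\<lambda>x::'a. (x, x)))"
    using closed_diagonal unfolding full_SetCompr_eq .
  then show ?thesis by (simp add: closed_operator_def linear_operator_def op_id_def)
qed

lemma has_cderiv_resolvent_power:
  assumes T: "linear_operator T" "z \<in> resolvent_set T"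
  shows "has_cderiv (\<lambda>\<zeta>. (ap (resolvent T \<zeta>) ^^ n) w)
    (of_nat n *\<^sub>C (ap (resolvent T z) ^^ Suc n) w) z"
proof (induction n)
  case 0
  show ?case by (simp add: has_cderiv_const scaleC.zero_left)
next
  case (Suc n)
  have R: "ap (resolvent T z) (c *\<^sub>C x) = c *\<^sub>C ap (resolvent T z) x" for c x
    using bounded_clinear_resolvent[OF T] by (simp add: bounded_clinear_def)
  have eq: "of_nat n *\<^sub>C (ap (resolvent T z) ^^ Suc n) w + ap (resolvent T z) ((ap (resolvent T z) ^^ n) w)
    = of_nat (Suc n) *\<^sub>C (ap (resolvent T z) ^^ Suc n) w"
    by (simp add: scaleC_add_left add.commute)
  have "opdom T \<subseteq> opdom (op_id :: ('a, 'a) operator)" by (simp add: op_id_def)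
  from has_cderiv_closed_resolvent[OF closed_operator_id T this Suc]
  have "has_cderiv (\<lambda>\<zeta>. ap (resolvent T \<zeta>) ((ap (resolvent T \<zeta>) ^^ n) w))
    (ap (resolvent T z) (of_nat (Suc n) *\<^sub>C (ap (resolvent T z) ^^ Suc n) w)) z"
    unfolding eq by (simp only: op_id_def operator.sel)
  then show ?case by (simp add: R)
qed

lemma has_cderiv_closed_resolvent_power:
  assumes "closed_operator V" and T: "linear_operator T" "z \<in> resolvent_set T"
    and "opdom T \<subseteq> opdom V"
  shows "has_cderiv (\<lambda>\<zeta>. ap V ((ap (resolvent T \<zeta>) ^^ Suc n) w))
    (of_nat (Suc n) *\<^sub>C ap V ((ap (resolvent T z) ^^ Suc (Suc n)) w)) z"
proof -
  have "bounded_clinear (\<lambda>y. ap V (ap (resolvent T z) y))"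
    by (rule bounded_clinear_closed_resolvent[OF assms])
  then have hom: "ap V (ap (resolvent T z) (c *\<^sub>C y)) = c *\<^sub>C ap V (ap (resolvent T z) y)" for c y
    by (simp add: bounded_clinear_def)
  have "of_nat n *\<^sub>C (ap (resolvent T z) ^^ Suc n) w + ap (resolvent T z) ((ap (resolvent T z) ^^ n) w)
    = of_nat (Suc n) *\<^sub>C (ap (resolvent T z) ^^ Suc n) w"
    by (simp add: scaleC_add_left add.commute)
  then show ?thesis
    using has_cderiv_closed_resolvent[OF assms has_cderiv_resolvent_power[OF T], of n w]
    by (simp only: hom funpow.simps comp_apply)
qed

lemma fact_inverse_scaleC: "(1 / fact l) *\<^sub>C fact l *\<^sub>C x = x"
  by (simp add: scaleC_scaleC)

text \<open>Iterated derivatives have meaning only on the resolvent set; since it is open, a formula that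
  holds throughout it can be differentiated again.\<close>

lemma cderiv_pow_closed_resolvent:
  assumes V: "closed_operator V" and T: "linear_operator T" and sub: "opdom T \<subseteq> opdom V"
    and z: "z \<in> resolvent_set T"
  shows "(cderiv ^^ l) (\<lambda>\<zeta>. x + ap V (ap (resolvent T \<zeta>) w)) z
    = (if l = 0 then x else 0) + fact l *\<^sub>C ap V ((ap (resolvent T z) ^^ Suc l) w)"
  using z
proof (induction l arbitrary: z)
  case 0
  show ?case by simp
next
  case (Suc l)
  have "has_cderiv (\<lambda>\<zeta>. (if l = 0 then x else 0) + fact l *\<^sub>C ap V ((ap (resolvent T \<zeta>) ^^ Suc l) w))
    (0 + fact l *\<^sub>C of_nat (Suc l) *\<^sub>C ap V ((ap (resolvent T z) ^^ Suc (Suc l)) w)) z"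
  proof (intro has_cderiv_add has_cderiv_const has_cderiv_bounded_clinear[where B = "scaleC (fact l)"])
    show "bounded_clinear (scaleC (fact l))"
      by (simp add: bounded_clinear_def scaleC.bounded_linear_right scaleC_scaleC mult.commute)
  qed (rule has_cderiv_closed_resolvent_power[OF V T Suc.prems sub])
  then have "has_cderiv ((cderiv ^^ l) (\<lambda>\<zeta>. x + ap V (ap (resolvent T \<zeta>) w)))
    (0 + fact l *\<^sub>C of_nat (Suc l) *\<^sub>C ap V ((ap (resolvent T z) ^^ Suc (Suc l)) w)) z"
    using open_resolvent_set[OF T] Suc.prems
    by (rule has_cderiv_cong_open) (simp only: Suc.IH)
  from cderiv_eqI[OF this] show ?case
    by (simp add: scaleC_scaleC algebra_simps)
qed


section \<open>Jordan chains\<close>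

lemma resolvent_recursion_solution:
  assumes R: "linear R" and f0: "f 0 = - R (u 0)"
    and rec: "\<And>j. j \<in> {1..<k} \<Longrightarrow> f j = R (f (j - 1) - u j)"
    and "j < k"
  shows "f j = - (\<Sum>l\<le>j. (R ^^ Suc l) (u (j - l)))"
  using \<open>j < k\<close>
proof (induction j)
  case 0
  show ?case using f0 by simp
next
  case (Suc j)
  interpret R: linear R by fact
  have "f (Suc j) = R (f j) - R (u (Suc j))" using rec[of "Suc j"] Suc.prems by (simp add: R.diff)
  also have "R (f j) = - (\<Sum>l\<le>j. (R ^^ Suc (Suc l)) (u (j - l)))"
    using Suc by (simp add: R.neg R.sum)
  finally show ?case by (simp add: sum.atMost_Suc_shift del: sum.atMost_Suc)
qed

theorem theorem4p5:
  fixes H0 H :: "('h::complex_hilbert, 'h) operator"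
    and V1 V2 :: "('h, 'k::complex_hilbert) operator"
    and A :: "complex \<Rightarrow> ('k, 'k) operator"
    and z0 :: complex
  assumes "separable_space (euclidean :: 'h topology)"
    and "separable_space (euclidean :: 'k topology)"
    and "closed_operator H0" and "resolvent_set H0 \<noteq> {}"
    and "closed_operator V1"
    and "linear_operator V2" and "closure (opdom V2) = UNIV"
    and "opdom H0 \<subseteq> opdom (op_comp (op_adjoint V2) V1)"
    and H: "H = op_add H0 (op_comp (op_adjoint V2) V1)"
    and z0: "z0 \<in> resolvent_set H0"
    and A: "A = (\<lambda>z. op_add op_id (op_comp V1 (op_comp (resolvent H0 z) (op_adjoint V2))))"
  shows "strongly_analytic_family (resolvent_set H0) (opdom (op_adjoint V2)) A \<and>
    (\<forall>k f. jordan_chain H z0 k f \<longrightarrow>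
           jordan_chain_family (resolvent_set H0) (opdom (op_adjoint V2)) A z0 k
             (\<lambda>j. ap V1 (f j))) \<and>
    (\<forall>k \<phi> f.
           jordan_chain_family (resolvent_set H0) (opdom (op_adjoint V2)) A z0 k \<phi> \<and>
           f 0 = - ap (resolvent H0 z0) (ap (op_adjoint V2) (\<phi> 0)) \<and>
           (\<forall>j\<in>{1..<k}.
              f j = ap (resolvent H0 z0)
                (f (j - 1) +
                 ap (op_adjoint V2)
                   (\<Sum>l\<le>j. ap V1 ((ap (resolvent H0 z0) ^^ (l + 1))
                              (ap (op_adjoint V2) (\<phi> (j - l))))))) \<longrightarrow>
           jordan_chain H z0 k f \<and> (\<forall>j<k. ap V1 (f j) = \<phi> j))"
proof -
  let ?\<rho> = "resolvent_set H0"
  define R where "R = (\<lambda>z. ap (resolvent H0 z))"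
  define W where "W = ap (op_adjoint V2)"
  define D where "D = opdom (op_adjoint V2)"
  have T: "linear_operator H0" using assms(3) by (simp add: closed_operator_def)
  have V: "linear_operator V1" using assms(5) by (simp add: closed_operator_def)
  have "linear_operator (op_adjoint V2)" by (rule linear_operator_adjoint[OF assms(7)])
  note W = linear_operatorD[OF this, folded W_def D_def]
  have W_minus: "W (- y) = - W y" if "y \<in> D" for y
    using W(6)[OF that, of "- 1"] by (simp add: scaleC.minus_left)
  have sub: "opdom H0 \<subseteq> opdom V1" "\<And>x. x \<in> opdom H0 \<Longrightarrow> ap V1 x \<in> D"
    using assms(8) by (auto simp: op_comp_def D_def)
  have R_mem: "R z y \<in> opdom H0" if "z \<in> ?\<rho>" for z y
    unfolding R_def by (rule resolvent_solves(1)[OF resolvent_set_bij[OF that]])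
  have VR: "bounded_clinear (\<lambda>y. ap V1 (R z y))" if "z \<in> ?\<rho>" for z
    unfolding R_def by (rule bounded_clinear_closed_resolvent[OF assms(5) T that sub(1)])
  have R_lin: "bounded_clinear (R z)" if "z \<in> ?\<rho>" for z
    unfolding R_def by (rule bounded_clinear_resolvent[OF T that])
  interpret R0: bounded_linear "R z0" using R_lin[OF z0] by (simp add: bounded_clinear_def)
  interpret VR0: bounded_linear "\<lambda>y. ap V1 (R z0 y)" using VR[OF z0] by (simp add: bounded_clinear_def)

  have A_ap: "ap (A z) \<phi> = \<phi> + ap V1 (R z (W \<phi>))" for z \<phi>
    by (simp add: A op_add_def op_id_def op_comp_def R_def W_def)
  have A_dom: "opdom (A z) = D" if "z \<in> ?\<rho>" for z
    using R_mem[OF that] sub(1) opdom_resolvent[OF that]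
    by (auto simp: A op_add_def op_id_def op_comp_def R_def D_def)
  have A_lin: "linear_operator (A z)" if z: "z \<in> ?\<rho>" for z
  proof -
    interpret VR: bounded_linear "\<lambda>y. ap V1 (R z y)" using VR[OF z] by (simp add: bounded_clinear_def)
    show ?thesis
      using VR[OF z] W
      by (simp add: linear_operator_def A_dom[OF z] A_ap VR.add scaleC_add_right bounded_clinear_def)
  qed
  have analytic: "strongly_analytic_family ?\<rho> D A"
    unfolding strongly_analytic_family_def
  proof (intro conjI ballI)
    fix \<phi> z assume "z \<in> ?\<rho>"
    from has_cderiv_add[OF has_cderiv_const
        has_cderiv_closed_resolvent[OF assms(5) T this sub(1) has_cderiv_const]]
    show "\<exists>d. has_cderiv (\<lambda>\<zeta>. ap (A \<zeta>) \<phi>) d z" unfolding A_ap R_def by blast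
  qed (simp_all add: open_resolvent_set T A_lin A_dom)

  have taylor: "(\<Sum>l\<le>j. (1 / fact l) *\<^sub>C (cderiv ^^ l) (\<lambda>z. ap (A z) (\<phi> (j - l))) z0)
    = \<phi> j + (\<Sum>l\<le>j. ap V1 ((R z0 ^^ Suc l) (W (\<phi> (j - l)))))" for j \<phi>
  proof -
    have "(1 / fact l) *\<^sub>C (cderiv ^^ l) (\<lambda>z. ap (A z) (\<phi> (j - l))) z0
      = (if l = 0 then \<phi> j else 0) + ap V1 ((R z0 ^^ Suc l) (W (\<phi> (j - l))))" for l
      by (simp add: fact_inverse_scaleC A_ap R_def scaleC_add_right scaleC.zero_right
          cderiv_pow_closed_resolvent[OF assms(5) T sub(1) z0])
    then show ?thesis by (simp add: sum.distrib)
  qed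
  have family_iff: "jordan_chain_family ?\<rho> D A z0 k \<phi> \<longleftrightarrow>
      1 \<le> k \<and> (\<forall>j<k. \<phi> j \<in> D) \<and> \<phi> 0 \<noteq> 0 \<and>
      (\<forall>j<k. \<phi> j + (\<Sum>l\<le>j. ap V1 ((R z0 ^^ Suc l) (W (\<phi> (j - l))))) = 0)" for k \<phi>
    using analytic z0 by (simp add: jordan_chain_family_def taylor)

  have H_dom: "opdom H = opdom H0"
    using assms(8) by (auto simp: H op_add_def)
  \<comment> \<open>With \<open>x = f\<^sub>j\<close> and \<open>y = f\<^sub>j\<^sub>-\<^sub>1\<close>, a chain equation of \<open>H\<close> becomes a step of the recursion.\<close>
  have H_shift: "ap (op_shift H z0) x = y \<longleftrightarrow> x = R z0 (y - W (ap V1 x))" if "x \<in> opdom H0" for x y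
  proof -
    have "ap (op_shift H z0) x = y \<longleftrightarrow> ap H0 x - z0 *\<^sub>C x = y - W (ap V1 x)"
      by (auto simp: H op_shift_def op_add_def op_comp_def W_def algebra_simps)
    also have "\<dots> \<longleftrightarrow> x = R z0 (y - W (ap V1 x))"
      using shift_eq_iff_fixpoint[OF resolvent_set_bij[OF z0], of x z0] that
      by (simp add: R_def scaleC.zero_left eq_commute)
    finally show ?thesis .
  qed
  have chain_iff: "jordan_chain H z0 k f \<longleftrightarrow> 1 \<le> k \<and> (\<forall>j<k. f j \<in> opdom H0) \<and> f 0 \<noteq> 0 \<and>
      f 0 = - R z0 (W (ap V1 (f 0))) \<and>
      (\<forall>j\<in>{1..<k}. f j = R z0 (f (j - 1) - W (ap V1 (f j))))" for k f
    unfolding jordan_chain_def H_dom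
    using H_shift[of "f 0" 0] H_shift by (auto simp: R0.neg)
  have V_solution: "ap V1 (f j) = - (\<Sum>l\<le>j. ap V1 ((R z0 ^^ Suc l) (u (j - l))))"
    if "f 0 = - R z0 (u 0)" "\<And>j. j \<in> {1..<k} \<Longrightarrow> f j = R z0 (f (j - 1) - u j)" "j < k" for f u k j
  proof -
    have "f j = - (\<Sum>l\<le>j. (R z0 ^^ Suc l) (u (j - l)))"
      by (rule resolvent_recursion_solution[OF R0.linear that])
    \<comment> \<open>One resolvent is kept next to \<open>V1\<close>, since \<open>V1\<close> on its own is linear only on its domain.\<close>
    also have "\<dots> = R z0 (- (\<Sum>l\<le>j. (R z0 ^^ l) (u (j - l))))" by (simp add: R0.neg R0.sum)
    finally show ?thesis by (simp add: VR0.neg VR0.sum)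
  qed

  have direct: "jordan_chain_family ?\<rho> D A z0 k (\<lambda>j. ap V1 (f j))" if "jordan_chain H z0 k f" for k f
  proof -
    from that have f: "1 \<le> k" "\<And>j. j < k \<Longrightarrow> f j \<in> opdom H0" "f 0 \<noteq> 0"
      and f0: "f 0 = - R z0 (W (ap V1 (f 0)))"
      and fj: "\<And>j. j \<in> {1..<k} \<Longrightarrow> f j = R z0 (f (j - 1) - W (ap V1 (f j)))"
      unfolding chain_iff by blast+
    have "ap V1 (f 0) \<noteq> 0" using f0 f(3) by (auto simp: W R0.zero)
    moreover have "ap V1 (f j) + (\<Sum>l\<le>j. ap V1 ((R z0 ^^ Suc l) (W (ap V1 (f (j - l)))))) = 0"
      if "j < k" for j
      using V_solution[OF f0 fj that] by (simp only: add.left_inverse)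
    ultimately show ?thesis unfolding family_iff using f sub(2) by blast
  qed

  have conv: "jordan_chain H z0 k f \<and> (\<forall>j<k. ap V1 (f j) = \<phi> j)"
    if chain: "jordan_chain_family ?\<rho> D A z0 k \<phi>" and f0: "f 0 = - R z0 (W (\<phi> 0))"
      and fj: "\<And>j. j \<in> {1..<k} \<Longrightarrow>
        f j = R z0 (f (j - 1) + W (\<Sum>l\<le>j. ap V1 ((R z0 ^^ (l + 1)) (W (\<phi> (j - l))))))" for k f \<phi>
  proof -
    from chain have k: "1 \<le> k" and \<phi>: "\<And>j. j < k \<Longrightarrow> \<phi> j \<in> D" "\<phi> 0 \<noteq> 0"
      and eq: "\<And>j. j < k \<Longrightarrow> \<phi> j + (\<Sum>l\<le>j. ap V1 ((R z0 ^^ Suc l) (W (\<phi> (j - l))))) = 0"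
      unfolding family_iff by blast+
    have sum: "(\<Sum>l\<le>j. ap V1 ((R z0 ^^ Suc l) (W (\<phi> (j - l))))) = - \<phi> j" if "j < k" for j
      by (rule minus_unique[OF eq[OF that], symmetric])
    have fj': "f j = R z0 (f (j - 1) - W (\<phi> j))" if "j \<in> {1..<k}" for j
      using fj[OF that] sum[of j] that \<phi>(1)[of j] by (simp add: W_minus)
    have Vf: "ap V1 (f j) = \<phi> j" if "j < k" for j
      using V_solution[of f "\<lambda>j. W (\<phi> j)", OF f0 fj' that] sum[OF that] by simp
    have "f j \<in> opdom H0" if "j < k" for j
    proof (cases "j = 0")
      case True
      then show ?thesis using f0 R_mem[OF z0, of "- W (\<phi> 0)"] by (simp add: R0.neg)
    next
      case False
      then have "j \<in> {1..<k}" using that by simp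
      then show ?thesis using fj' R_mem[OF z0] by metis
    qed
    moreover have "f 0 \<noteq> 0" using Vf[of 0] k \<phi>(2) linear_operatorD(2)[OF V] by auto
    moreover have "f 0 = - R z0 (W (ap V1 (f 0)))"
    proof -
      have "ap V1 (f 0) = \<phi> 0" using Vf k by simp
      show ?thesis unfolding \<open>ap V1 (f 0) = \<phi> 0\<close> by (rule f0)
    qed
    moreover have "f j = R z0 (f (j - 1) - W (ap V1 (f j)))" if "j \<in> {1..<k}" for j
    proof -
      have "ap V1 (f j) = \<phi> j" using Vf that by simp
      show ?thesis unfolding \<open>ap V1 (f j) = \<phi> j\<close> by (rule fj'[OF that])
    qed
    ultimately show ?thesis unfolding chain_iff using k Vf by blast
  qed

  show ?thesis
    using analytic direct conv unfolding R_def W_def D_def by blast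
qed

end
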